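(* Let $(J_n)_{n\geq 0}$ be the Jacobsthal numbers, defined by $J_0=0$, $J_1=1$ and $J_n=J_{n-1}+2J_{n-2}$ for $n\geq 2$. Then $$J_{n+k}=J_{n+1}J_k+2J_nJ_{k-1}\qquad\text{for all integers } n\geq 0,\ k\geq 1,$$ $$J_{2n}=(J_{n+1}+2J_{n-1})J_n\qquad\text{for all integers } n\geq 1,$$ $$J_{2n+1}=J_{n+1}^2+2J_n^2\qquad\text{for all integers } n\geq 0.$$ *)

theory Defs
  imports Main
begin

fun jacobsthal :: "nat \<Rightarrow> nat" where
  "jacobsthal 0 = 0"
| "jacobsthal (Suc 0) = 1"
| "jacobsthal (Suc (Suc n)) = jacobsthal (Suc n) + 2 * jacobsthal n"

end

theory Submission
  imports Defs
begin

text \<open>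
  Everything follows from the addition formula; the two doubling formulas are its
  cases \<open>k = n\<close> and \<open>k = n + 1\<close>. The addition formula holds because a sequence
  satisfying the Jacobsthal recurrence is determined by two consecutive terms, so
  \<open>J(n + k)\<close> is a linear combination of \<open>J(k)\<close> and \<open>J(k - 1)\<close>, whose coefficients
  depend only on \<open>n\<close> and turn out to be \<open>J(n + 1)\<close> and \<open>2 J(n)\<close>.
\<close>

text \<open>
  The sum \<open>n + (k + 1)\<close> stays the same when a unit is moved from \<open>n\<close> to \<open>k\<close>, so
  induction on \<open>n\<close> for all \<open>k\<close> at once needs a single instance of the hypothesis, and
  one use of the recurrence on each side matches the two expressions. Writing the
  second summand as a successor avoids truncated subtraction.
\<close>

lemma jacobsthal_add_Suc:
  "jacobsthal (n + Suc k) =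
     jacobsthal (Suc n) * jacobsthal (Suc k) + 2 * jacobsthal n * jacobsthal k"
proof (induction n arbitrary: k)
  case 0
  show ?case by simp
next
  case (Suc n)
  have "jacobsthal (Suc n + Suc k) = jacobsthal (n + Suc (Suc k))"
    by simp
  also have "\<dots> = jacobsthal (Suc n) * jacobsthal (Suc (Suc k))
      + 2 * jacobsthal n * jacobsthal (Suc k)"
    by (rule Suc.IH)
  also have "\<dots> = jacobsthal (Suc (Suc n)) * jacobsthal (Suc k)
      + 2 * jacobsthal (Suc n) * jacobsthal k"
    by (simp add: algebra_simps)
  finally show ?case .
qed

theorem corollary3:
  shows "(\<forall>(n::nat) (k::nat). k \<ge> 1 \<longrightarrow>
            jacobsthal (n + k) =
              jacobsthal (n + 1) * jacobsthal k + 2 * jacobsthal n * jacobsthal (k - 1))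
       \<and> (\<forall>n::nat. n \<ge> 1 \<longrightarrow>
            jacobsthal (2 * n) =
              (jacobsthal (n + 1) + 2 * jacobsthal (n - 1)) * jacobsthal n)
       \<and> (\<forall>n::nat.
            jacobsthal (2 * n + 1) = (jacobsthal (n + 1))\<^sup>2 + 2 * (jacobsthal n)\<^sup>2)"
proof (intro conjI allI impI)
  fix n k :: nat
  assume "k \<ge> 1"
  then obtain j where "k = Suc j" by (cases k) auto
  then show "jacobsthal (n + k) =
      jacobsthal (n + 1) * jacobsthal k + 2 * jacobsthal n * jacobsthal (k - 1)"
    using jacobsthal_add_Suc[of n j] by simp
next
  fix n :: nat
  assume "n \<ge> 1"
  then obtain m where n: "n = Suc m" by (cases n) auto
  have "jacobsthal (2 * n) = jacobsthal (n + Suc m)"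
    by (simp add: n mult_2)
  also have "\<dots> = jacobsthal (Suc n) * jacobsthal (Suc m) + 2 * jacobsthal n * jacobsthal m"
    by (rule jacobsthal_add_Suc)
  also have "\<dots> = (jacobsthal (n + 1) + 2 * jacobsthal (n - 1)) * jacobsthal n"
    by (simp add: n algebra_simps)
  finally show "jacobsthal (2 * n) =
      (jacobsthal (n + 1) + 2 * jacobsthal (n - 1)) * jacobsthal n" .
next
  fix n :: nat
  show "jacobsthal (2 * n + 1) = (jacobsthal (n + 1))\<^sup>2 + 2 * (jacobsthal n)\<^sup>2"
    using jacobsthal_add_Suc[of n n] by (simp add: mult_2[of n] power2_eq_square)
qed

end
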